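(* Let $T(z)=\prod_{j=0}^{\infty}(1-z^{2^j})$ and $M(z)=\sum_{j=0}^{\infty}\dfrac{(-1)^j z^{2^j}}{\prod_{i=0}^{j-1}(1-z^{2^i})}$ (power series converging for $|z|<1$). Then for every integer $b\ge2$, \[\mu\left(T\left(\tfrac1b\right),M\left(\tfrac1b\right)\right)\le\tfrac{32}{17}.\] Moreover, if $a/b\in\mathbb{Q}$ with $a,b$ integers, $b\ge2$, $\log|a|=\lambda\log b$ and $0\le\lambda<1/2$, then \[\mu\left(T\left(\tfrac ab\right),M\left(\tfrac ab\right)\right)\le\frac{32(1-\lambda)}{17-26\lambda}.\]
   Context: For real numbers $\alpha_1,\dots,\alpha_n$, the simultaneous approximation exponent $\mu(\alpha_1,\dots,\alpha_n)$ is the supremum of the real numbers $\mu$ such that the inequality $\max_{1\le i\le n}|\alpha_i-p_i/q|<q^{-\mu}$ has infinitely many solutions in rational numbers $p_i/q$ (with common denominator $q\ge1$). The series $M$ satisfies $M(z^2)=(z-1)(M(z)-z)$ and $T$ satisfies $T(z)=(1-z)T(z^2)$. *)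

theory Defs
  imports "HOL-Analysis.Analysis" "HOL-Library.Extended_Real"
begin

definition sim_approx_exp :: "real list \<Rightarrow> ereal" where
  "sim_approx_exp alphas = Sup {ereal mu | mu.
     infinite {(ps :: int list, q :: int). length ps = length alphas \<and> q \<ge> 1 \<and>
       (\<forall>i < length alphas. \<bar>alphas ! i - real_of_int (ps ! i) / real_of_int q\<bar>
                              < real_of_int q powr (- mu))}}"

definition T_fun :: "real \<Rightarrow> real" where
  "T_fun z = (\<Prod>j. 1 - z ^ (2 ^ j))"

definition M_fun :: "real \<Rightarrow> real" where
  "M_fun z = (\<Sum>j. (-1) ^ j * z ^ (2 ^ j) / (\<Prod>i<j. 1 - z ^ (2 ^ i)))"

end

theory Submission
  imports Defs
begin

text \<open>With \<open>P\<^sub>k(z) = \<Prod>i<k. 1 - z ^ 2 ^ i\<close>, iterating the functional equations gives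
  \<open>T(z) = P\<^sub>k(z) T(w)\<close> and \<open>P\<^sub>k(z) M(z) = Q\<^sub>k(z) + (-1)^k M(w)\<close> for \<open>w = z ^ 2 ^ k\<close>. Hence a linear form
  \<open>A0 + A1 T + A2 M\<close> with integer polynomial coefficients of degrees at most \<open>d - 1\<close>, \<open>d\<close>, \<open>d - 2\<close>
  that vanishes at \<open>0\<close> to order exactly \<open>s\<close>, taken at \<open>w\<close> and multiplied by \<open>P\<^sub>k(z)\<close>, becomes a form in
  \<open>1, T(z), M(z)\<close> whose coefficients at \<open>z = a/b\<close> have denominator \<open>b ^ (d 2^k)\<close> and whose value has the
  exact size \<open>\<bar>z\<bar> ^ (s 2^k)\<close>. Substituting approximations \<open>p1/q, p2/q\<close> for \<open>T(z), M(z)\<close> gives a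
  rational number that either vanishes, in which case the value of the form is at most of order
  \<open>q powr - \<mu>\<close>, or is at least \<open>1 / (q b ^ (d 2^k))\<close> in modulus. Choosing the first level at which the value of the
  form is negligible compared with this last quantity bounds \<open>q\<close> when \<open>\<mu>\<close> exceeds the stated exponent.\<close>

section \<open>A criterion for the simultaneous approximation exponent\<close>

text \<open>\<open>N n\<close> is a common denominator and \<open>eps n\<close> the size of the n-th
  form. At the first level n where \<open>eps n * N n\<close> drops below a constant times 1/q,
  minimality bounds \<open>eps m * N m\<close> from below at the preceding level m; the gap
  conditions then make \<open>eps n\<close> at least of order q^(-mu0) and \<open>N n\<close> at
  most of order q^(mu0 - 1).\<close>

lemma simultaneous_approx_bounded_denominator:
  fixes x y :: real and B0 B1 B2 N eps :: "nat \<Rightarrow> real"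
  assumes N: "\<And>n. N n > 0" and eps: "\<And>n. eps n > 0" and E: "E > 0"
    and ints: "\<And>n. N n * B0 n \<in> \<int>" "\<And>n. N n * B1 n \<in> \<int>" "\<And>n. N n * B2 n \<in> \<int>"
    and bounds: "\<And>n. \<bar>B1 n\<bar> \<le> E" "\<And>n. \<bar>B2 n\<bar> \<le> E"
    and lower: "\<And>n. eps n / E \<le> \<bar>B0 n + B1 n * x + B2 n * y\<bar>"
    and upper: "\<And>n. \<bar>B0 n + B1 n * x + B2 n * y\<bar> \<le> E * eps n"
    and lim: "(\<lambda>n. eps n * N n) \<longlonglongrightarrow> 0"
    and gap1: "\<And>n. (eps n * N n) powr mu0 \<le> eps (Suc n)"
    and gap2: "\<And>n. N (Suc n) \<le> (eps n * N n) powr (1 - mu0)"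
    and mu0: "1 \<le> mu0" and mu: "mu0 < mu"
  obtains Q :: real where
    "\<And>(p1::int) (p2::int) (q::int). q \<ge> 1 \<Longrightarrow> \<bar>x - p1 / q\<bar> < real_of_int q powr - mu \<Longrightarrow>
       \<bar>y - p2 / q\<bar> < real_of_int q powr - mu \<Longrightarrow> real_of_int q \<le> Q"
proof -
  \<comment> \<open>The factor 2 collects the errors in both coordinates and makes the term with
    \<open>E * eps n\<close> contribute less than 1/2 below. \<open>Z\<close> is the maximum of the
    bounds from the two cases.\<close>
  define K where "K = 2 * E"
  define Z where "Z = max (E * K * K powr mu0) (2 * K powr mu0)"
  have K: "K > 0" using E by (simp add: K_def)
  \<comment> \<open>The assumption \<open>large\<close> says that level 0 is not yet small, so the
    first small level has a predecessor. All other q are bounded outright at the end.\<close>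
  have main: "r powr (mu - mu0) \<le> Z"
    if q: "q \<ge> 1" and r: "r = real_of_int q" and large: "1 \<le> K * r * (eps 0 * N 0)"
      and x: "\<bar>x - p1 / q\<bar> < r powr - mu" and y: "\<bar>y - p2 / q\<bar> < r powr - mu"
    for p1 p2 q :: int and r :: real
  proof -
    have r1: "r \<ge> 1" using q r by simp
    have "(\<lambda>n. K * r * (eps n * N n)) \<longlonglongrightarrow> K * r * 0"
      by (intro tendsto_intros lim)
    then have "\<forall>\<^sub>F n in sequentially. K * r * (eps n * N n) < 1"
      by (intro order_tendstoD(2)) auto
    then obtain n0 where n0: "K * r * (eps n0 * N n0) < 1"
      by (auto simp: eventually_sequentially)
    obtain m where m: "1 \<le> K * r * (eps m * N m)" and "K * r * (eps (Suc m) * N (Suc m)) < 1"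
    proof -
      have "\<exists>m<n0. (\<forall>i\<le>m. \<not> K * r * (eps i * N i) < 1) \<and> K * r * (eps (Suc m) * N (Suc m)) < 1"
        using n0 large by (intro ex_least_nat_less) auto
      then show ?thesis using that by (meson not_le order_refl)
    qed
    define n where "n = Suc m"
    have n: "K * r * (eps n * N n) < 1" unfolding n_def by fact
    define d where "d = eps m * N m"
    have d: "d > 0" "1 / (K * r) \<le> d"
      using m eps N K r1 by (auto simp: d_def field_simps)
    define L where "L = B0 n + B1 n * x + B2 n * y"
    define D where "D = B0 n + B1 n * (p1 / q) + B2 n * (p2 / q)"
    have "L - D = B1 n * (x - p1 / q) + B2 n * (y - p2 / q)"
      by (simp add: L_def D_def algebra_simps)
    also have "\<bar>\<dots>\<bar> \<le> E * r powr - mu + E * r powr - mu"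
      using bounds x y E
      by (intro order.trans[OF abs_triangle_ineq] add_mono) (auto simp: abs_mult intro!: mult_mono)
    finally have LD: "\<bar>L - D\<bar> \<le> K * r powr - mu"
      by (simp add: K_def)
    have pow: "(1 / (K * r)) powr e = K powr - e * r powr - e" for e
      using K r1 by (simp add: powr_divide powr_mult powr_minus field_simps)
    show ?thesis
    proof (cases "D = 0")
      case True
      \<comment> \<open>Here \<open>L\<close> is itself the substitution error, so its lower bound
        \<open>eps n / E\<close> cannot exceed \<open>K * r powr - mu\<close>.\<close>
      have "K powr - mu0 * r powr - mu0 \<le> d powr mu0"
        unfolding pow[symmetric] using d K r1 mu0 by (intro powr_mono2) auto
      also have "\<dots> \<le> eps n" using gap1[of m] by (simp add: d_def n_def)
      also have "\<dots> \<le> E * \<bar>L\<bar>" using lower[of n] E by (simp add: L_def field_simps)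
      also have "\<dots> \<le> E * (K * r powr - mu)" using LD True E by simp
      finally have "K powr - mu0 * r powr - mu0 * (K powr mu0 * r powr mu)
           \<le> E * (K * r powr - mu) * (K powr mu0 * r powr mu)"
        using K by (intro mult_right_mono) auto
      also have "\<dots> = E * K * K powr mu0"
        using r1 by (simp add: powr_minus field_simps)
      also have "K powr - mu0 * r powr - mu0 * (K powr mu0 * r powr mu) = r powr (mu - mu0)"
        using r1 K by (simp add: powr_minus powr_diff field_simps)
      finally show ?thesis by (simp add: Z_def)
    next
      case False
      \<comment> \<open>\<open>N n\<close> clears the coefficients and \<open>r\<close> the
        denominators of the approximations, giving a nonzero integer. By the choice of n, at least
        1/2 of its modulus is left to the approximation error.\<close>
      have "r * N n * D = r * (N n * B0 n) + (N n * B1 n) * p1 + (N n * B2 n) * p2"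
        using r1 by (simp add: D_def r[symmetric] field_simps)
      also have "\<dots> \<in> \<int>"
        unfolding r by (intro Ints_add Ints_mult[OF Ints_of_int] Ints_mult[OF _ Ints_of_int] ints)
      finally have "1 \<le> \<bar>r * N n * D\<bar>"
        using False N[of n] r1 by (intro Ints_nonzero_abs_ge1) auto
      also have "\<dots> = r * N n * \<bar>D\<bar>"
        using N[of n] r1 by (simp add: abs_mult)
      also have "\<dots> \<le> r * N n * (E * eps n + K * r powr - mu)"
        using LD upper[of n] N[of n] r1 by (intro mult_left_mono) (auto simp: L_def)
      also have "\<dots> = (K * r * (eps n * N n)) / 2 + N n * (K * (r * r powr - mu))"
        by (simp add: K_def algebra_simps)
      finally have "1 / 2 \<le> N n * (K * (r * r powr - mu))"
        using n by simp
      also have "\<dots> \<le> (K powr (mu0 - 1) * r powr (mu0 - 1)) * (K * (r * r powr - mu))"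
      proof (rule mult_right_mono)
        have "N n \<le> d powr (1 - mu0)" using gap2[of m] by (simp add: n_def d_def)
        also have "\<dots> \<le> (1 / (K * r)) powr (1 - mu0)"
          using d K r1 mu0 by (intro powr_mono2') auto
        finally show "N n \<le> K powr (mu0 - 1) * r powr (mu0 - 1)" by (simp add: pow)
      qed (use K r1 in auto)
      also have "\<dots> = K powr mu0 * r powr (mu0 - mu)"
        using K r1 by (simp add: powr_diff powr_minus field_simps)
      finally have "1 / 2 * r powr (mu - mu0) \<le> K powr mu0 * r powr (mu0 - mu) * r powr (mu - mu0)"
        by (intro mult_right_mono) auto
      also have "\<dots> = K powr mu0"
        using r1 by (simp add: mult.assoc flip: powr_add)
      finally show ?thesis by (simp add: Z_def)
    qed
  qed
  define Q where "Q = max (1 / (K * (eps 0 * N 0))) (Z powr (1 / (mu - mu0)))"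
  show ?thesis
  proof (rule that[of Q])
    fix p1 p2 q :: int
    assume q: "q \<ge> 1" and x: "\<bar>x - p1 / q\<bar> < real_of_int q powr - mu"
      and y: "\<bar>y - p2 / q\<bar> < real_of_int q powr - mu"
    show "real_of_int q \<le> Q"
    proof (cases "1 \<le> K * real_of_int q * (eps 0 * N 0)")
      case True
      have "real_of_int q = (real_of_int q powr (mu - mu0)) powr (1 / (mu - mu0))"
        using q mu by (simp add: powr_powr)
      also have "\<dots> \<le> Z powr (1 / (mu - mu0))"
        using main[OF q refl True x y] mu by (intro powr_mono2) auto
      finally show ?thesis by (simp add: Q_def)
    next
      case False
      then have "real_of_int q \<le> 1 / (K * (eps 0 * N 0))"
        using K eps[of 0] N[of 0] by (simp add: field_simps)
      then show ?thesis by (simp add: Q_def)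
    qed
  qed
qed

text \<open>Bounding q leaves finitely many solutions because mu > 0 gives q^(-mu) \<le> 1, which
  confines both numerators to a fixed interval.\<close>

lemma sim_approx_exp_pair_le:
  fixes x y mu0 :: real
  assumes "mu0 \<ge> 0"
    and "\<And>mu. mu > mu0 \<Longrightarrow> \<exists>Q::real. \<forall>(p1::int) (p2::int) (q::int). q \<ge> 1 \<longrightarrow>
      \<bar>x - p1 / q\<bar> < real_of_int q powr - mu \<longrightarrow> \<bar>y - p2 / q\<bar> < real_of_int q powr - mu \<longrightarrow>
      real_of_int q \<le> Q"
  shows "sim_approx_exp [x, y] \<le> ereal mu0"
  unfolding sim_approx_exp_def
proof (rule Sup_least, safe)
  fix mu
  let ?S = "{(ps :: int list, q :: int). length ps = length [x, y] \<and> q \<ge> 1 \<and>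
       (\<forall>i < length [x, y]. \<bar>[x, y] ! i - real_of_int (ps ! i) / real_of_int q\<bar>
                              < real_of_int q powr (- mu))}"
  assume inf: "infinite ?S"
  show "ereal mu \<le> ereal mu0"
  proof (rule ccontr)
    assume "\<not> ereal mu \<le> ereal mu0"
    then have mu: "mu > mu0" by simp
    obtain Q :: real where Q: "\<And>(p1::int) (p2::int) (q::int). q \<ge> 1 \<Longrightarrow>
      \<bar>x - p1 / q\<bar> < real_of_int q powr - mu \<Longrightarrow> \<bar>y - p2 / q\<bar> < real_of_int q powr - mu \<Longrightarrow>
      real_of_int q \<le> Q"
      using assms(2)[OF mu] by blast
    define R where "R = \<lceil>Q * (1 + \<bar>x\<bar> + \<bar>y\<bar>)\<rceil>"
    have le_R: "\<bar>p\<bar> \<le> R"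
      if q: "q \<ge> 1" "real_of_int q \<le> Q" and u: "\<bar>u - p / q\<bar> < real_of_int q powr - mu"
        and v: "\<bar>u\<bar> \<le> \<bar>x\<bar> + \<bar>y\<bar>" for p q :: int and u
    proof -
      have "real_of_int q powr - mu \<le> real_of_int q powr 0"
        using q mu assms(1) by (intro powr_mono) auto
      then have "\<bar>u - p / q\<bar> \<le> 1" using u q by simp
      then have "\<bar>p / q\<bar> \<le> 1 + \<bar>x\<bar> + \<bar>y\<bar>" using v by linarith
      then have "\<bar>real_of_int p\<bar> \<le> q * (1 + \<bar>x\<bar> + \<bar>y\<bar>)" using q by (simp add: field_simps)
      also have "\<dots> \<le> Q * (1 + \<bar>x\<bar> + \<bar>y\<bar>)" using q by (intro mult_right_mono) auto
      finally show ?thesis unfolding R_def by linarith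
    qed
    have "?S \<subseteq> {ps. set ps \<subseteq> {-R..R} \<and> length ps = 2} \<times> {1..\<lfloor>Q\<rfloor>}"
    proof safe
      fix ps :: "int list" and q :: int
      assume len: "length ps = length [x, y]" and q: "1 \<le> q"
        and close: "\<forall>i<length [x, y]. \<bar>[x, y] ! i - real_of_int (ps ! i) / real_of_int q\<bar>
              < real_of_int q powr - mu"
      obtain p1 p2 where ps: "ps = [p1, p2]"
        using len by (auto simp: length_Suc_conv numeral_2_eq_2)
      have 1: "\<bar>x - p1 / q\<bar> < real_of_int q powr - mu" using spec[OF close, of 0] ps by simp
      have 2: "\<bar>y - p2 / q\<bar> < real_of_int q powr - mu" using spec[OF close, of 1] ps by simp
      note qQ = Q[OF q 1 2]
      show "q \<in> {1..\<lfloor>Q\<rfloor>}" using q qQ by (simp add: le_floor_iff)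
      show "length ps = 2" using len by simp
      show "\<And>p. p \<in> set ps \<Longrightarrow> p \<in> {-R..R}"
        using le_R[OF q qQ 1] le_R[OF q qQ 2] ps by (auto simp: abs_le_iff)
    qed
    moreover have "finite ({ps. set ps \<subseteq> {-R..R} \<and> length ps = 2} \<times> {1..\<lfloor>Q\<rfloor>})"
      by (intro finite_cartesian_product finite_lists_length_eq) auto
    ultimately show False using inf finite_subset by blast
  qed
qed

section \<open>The functional equations\<close>

definition P_fun :: "nat \<Rightarrow> real \<Rightarrow> real" where
  "P_fun k z = (\<Prod>i<k. 1 - z ^ 2 ^ i)"

text \<open>The inhomogeneous part of the iterated equation: multiplying by 1 - w with w = z^(2^k)
  turns (1 - w) M(w) into (1 - w) w - M(w^2).\<close>

fun Q_fun :: "nat \<Rightarrow> real \<Rightarrow> real" where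
  "Q_fun 0 z = 0"
| "Q_fun (Suc k) z = (1 - z ^ 2 ^ k) * (Q_fun k z + (-1) ^ k * z ^ 2 ^ k)"

section \<open>Convergence and non-vanishing of the product T\<close>

lemma summable_power_power2:
  fixes z :: real
  assumes "\<bar>z\<bar> < 1"
  shows "summable (\<lambda>j. \<bar>z\<bar> ^ 2 ^ j)"
proof (rule summable_comparison_test)
  show "summable (\<lambda>j. \<bar>z\<bar> ^ j)"
    using assms by (simp add: summable_geometric)
  have "\<bar>z\<bar> ^ 2 ^ j \<le> \<bar>z\<bar> ^ j" for j
    using assms by (intro power_decreasing) (auto simp: less_imp_le)
  then show "\<exists>N. \<forall>n\<ge>N. norm (\<bar>z\<bar> ^ 2 ^ n) \<le> \<bar>z\<bar> ^ n"
    by auto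
qed

lemma power_power2_tendsto_0:
  fixes z :: real
  assumes "\<bar>z\<bar> < 1"
  shows "(\<lambda>j. z ^ 2 ^ j) \<longlonglongrightarrow> 0"
proof -
  have "(\<lambda>j. \<bar>z ^ 2 ^ j\<bar>) \<longlonglongrightarrow> 0"
    using summable_LIMSEQ_zero[OF summable_power_power2[OF assms]] by (simp add: power_abs)
  then show ?thesis
    by (rule tendsto_rabs_zero_cancel)
qed

text \<open>Since 2^j \<ge> j + 1, a geometric series of ratio 1/2 dominates. The bound is linear in
  z and uniform in n.\<close>

lemma sum_power_power2_le:
  fixes z :: real
  assumes "0 \<le> z" "z \<le> 1 / 2"
  shows "(\<Sum>j<n. z ^ 2 ^ j) \<le> 2 * z"
proof -
  have "z ^ 2 ^ j \<le> z * (1 / 2) ^ j" for j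
  proof -
    have "z ^ 2 ^ j \<le> z ^ Suc j"
      using assms by (intro power_decreasing) (auto simp: Suc_le_eq)
    also have "\<dots> \<le> z * (1 / 2) ^ j"
      using assms by (simp add: mult_left_mono power_mono del: power_one_over)
    finally show ?thesis .
  qed
  then have "(\<Sum>j<n. z ^ 2 ^ j) \<le> (\<Sum>j<n. z * (1 / 2) ^ j)"
    by (intro sum_mono) auto
  also have "\<dots> = z * (\<Sum>j<n. (1 / 2) ^ j)"
    by (simp add: sum_distrib_left)
  also have "\<dots> \<le> z * 2"
    using assms by (intro mult_left_mono) (auto simp: sum_gp_strict)
  finally show ?thesis by simp
qed

lemma power_power2_neq_1:
  fixes z :: real
  assumes "\<bar>z\<bar> < 1"
  shows "z ^ 2 ^ j \<noteq> 1"
proof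
  assume "z ^ 2 ^ j = 1"
  then have "\<bar>z\<bar> ^ 2 ^ j = 1" by (metis abs_1 power_abs)
  moreover have "\<bar>z\<bar> ^ 2 ^ j < 1" using assms by (intro power_less_one_iff[THEN iffD2]) auto
  ultimately show False by simp
qed

lemma T_convergent_prod:
  fixes z :: real
  assumes "\<bar>z\<bar> < 1"
  shows "convergent_prod (\<lambda>j. 1 - z ^ 2 ^ j)"
proof -
  have "convergent_prod (\<lambda>j. 1 + (- (z ^ 2 ^ j)))"
    using summable_power_power2[OF assms] power_power2_neq_1[OF assms]
    by (intro summable_imp_convergent_prod_real) (auto simp: power_abs)
  then show ?thesis by simp
qed

lemma T_fun_nonzero:
  assumes "\<bar>z\<bar> < 1"
  shows "T_fun z \<noteq> 0"
  unfolding T_fun_def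
  using T_convergent_prod[OF assms] power_power2_neq_1[OF assms]
  by (intro prodinf_nonzero) auto

lemma T_fun_rec:
  assumes "\<bar>z\<bar> < 1"
  shows "T_fun z = (1 - z) * T_fun (z\<^sup>2)"
proof -
  have "(\<Prod>n. 1 - z ^ 2 ^ Suc n) = T_fun z / (1 - z ^ 2 ^ 0)"
    unfolding T_fun_def using T_convergent_prod[OF assms] assms
    by (intro prodinf_split_head) auto
  then show ?thesis
    using assms by (simp add: T_fun_def power_mult)
qed

lemma P_fun_tendsto_T_fun:
  assumes "\<bar>z\<bar> < 1"
  shows "(\<lambda>k. P_fun k z) \<longlonglongrightarrow> T_fun z"
proof -
  have "(\<lambda>n. P_fun (Suc n) z) \<longlonglongrightarrow> T_fun z"
    using convergent_prod_LIMSEQ[OF T_convergent_prod[OF assms]]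
    by (simp add: P_fun_def T_fun_def lessThan_Suc_atMost)
  then show ?thesis by (rule LIMSEQ_imp_Suc)
qed

section \<open>Estimates near the origin and convergence of the series M\<close>

definition M_term :: "real \<Rightarrow> nat \<Rightarrow> real" where
  "M_term z j = (-1) ^ j * z ^ (2 ^ j) / (\<Prod>i<j. 1 - z ^ (2 ^ i))"

lemma M_fun_eq: "M_fun z = (\<Sum>j. M_term z j)"
  by (simp add: M_fun_def M_term_def)

lemma M_term_Suc: "M_term z (Suc j) = - M_term (z\<^sup>2) j / (1 - z)"
  by (simp add: M_term_def prod.lessThan_Suc_shift power_mult del: prod.lessThan_Suc)

text \<open>Comparison with the product of 1 + |z|^(2^i) and then with an exponential. The constants
  come from exp x \<le> 1 + 2x for 0 \<le> x \<le> 1/2, applied to x = 2|z|.\<close>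

lemma P_fun_minus_1_bound:
  assumes "\<bar>z\<bar> \<le> 1 / 4"
  shows "\<bar>P_fun n z - 1\<bar> \<le> 4 * \<bar>z\<bar>"
proof -
  have "\<bar>(\<Prod>i<n. 1 + - (z ^ 2 ^ i)) - 1\<bar> \<le> (\<Prod>i<n. 1 + \<bar>z\<bar> ^ 2 ^ i) - 1"
    using norm_prod_minus1_le_prod_minus1[of "\<lambda>i. - (z ^ 2 ^ i)" "{..<n}"] by (simp add: power_abs)
  also have "\<dots> \<le> exp (\<Sum>i<n. \<bar>z\<bar> ^ 2 ^ i) - 1"
    using prod_le_exp_sum[of "{..<n}" "\<lambda>i. \<bar>z\<bar> ^ 2 ^ i"] by simp
  also have "\<dots> \<le> exp (2 * \<bar>z\<bar>) - 1"
    using sum_power_power2_le[of "\<bar>z\<bar>" n] assms by simp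
  also have "\<dots> \<le> 4 * \<bar>z\<bar>"
    using real_exp_bound_lemma[of "2 * \<bar>z\<bar>"] assms by simp
  finally show ?thesis by (simp add: P_fun_def)
qed

lemma T_fun_minus_1_bound:
  assumes "\<bar>z\<bar> \<le> 1 / 4"
  shows "\<bar>T_fun z - 1\<bar> \<le> 4 * \<bar>z\<bar>"
proof (rule tendsto_upperbound)
  show "(\<lambda>n. \<bar>P_fun n z - 1\<bar>) \<longlonglongrightarrow> \<bar>T_fun z - 1\<bar>"
    using assms by (intro tendsto_intros P_fun_tendsto_T_fun) auto
qed (use P_fun_minus_1_bound[OF assms] in auto)

lemma M_term_bound:
  assumes "\<bar>z\<bar> \<le> 1 / 8"
  shows "\<bar>M_term z j\<bar> \<le> 2 * \<bar>z\<bar> ^ 2 ^ j"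
proof -
  have "1 / 2 \<le> \<bar>P_fun j z\<bar>"
    using P_fun_minus_1_bound[of z j] assms by linarith
  then have "\<bar>z\<bar> ^ 2 ^ j / \<bar>P_fun j z\<bar> \<le> \<bar>z\<bar> ^ 2 ^ j / (1 / 2)"
    by (intro divide_left_mono) auto
  then show ?thesis
    by (simp add: M_term_def P_fun_def abs_mult power_abs)
qed

lemma M_term_summable_small:
  assumes "\<bar>z\<bar> \<le> 1 / 8"
  shows "summable (\<lambda>j. \<bar>M_term z j\<bar>)"
proof (rule summable_comparison_test)
  show "summable (\<lambda>j. 2 * \<bar>z\<bar> ^ 2 ^ j)"
    using assms by (intro summable_mult summable_power_power2) auto
  show "\<exists>N. \<forall>n\<ge>N. norm \<bar>M_term z n\<bar> \<le> 2 * \<bar>z\<bar> ^ 2 ^ n"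
    using M_term_bound[OF assms] by auto
qed

lemma M_fun_bound:
  assumes "\<bar>z\<bar> \<le> 1 / 8"
  shows "\<bar>M_fun z\<bar> \<le> 4 * \<bar>z\<bar>"
proof -
  have "\<bar>M_fun z\<bar> \<le> (\<Sum>j. \<bar>M_term z j\<bar>)"
    unfolding M_fun_eq using M_term_summable_small[OF assms] by (rule summable_rabs)
  also have "\<dots> \<le> 4 * \<bar>z\<bar>"
  proof (rule suminf_le_const[OF M_term_summable_small[OF assms]])
    fix n
    have "(\<Sum>j<n. \<bar>M_term z j\<bar>) \<le> (\<Sum>j<n. 2 * \<bar>z\<bar> ^ 2 ^ j)"
      using M_term_bound[OF assms] by (intro sum_mono)
    also have "\<dots> \<le> 4 * \<bar>z\<bar>"
      using sum_power_power2_le[of "\<bar>z\<bar>" n] assms by (simp flip: sum_distrib_left)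
    finally show "(\<Sum>j<n. \<bar>M_term z j\<bar>) \<le> 4 * \<bar>z\<bar>" .
  qed
  finally show ?thesis .
qed

text \<open>The direct bound on the terms covers only |z| \<le> 1/8. By \<open>M_term_Suc\<close>
  summability passes from x^2 to x, and repeated squaring brings any |z| < 1 into the small
  disc.\<close>

lemma M_term_summable:
  assumes "\<bar>z\<bar> < 1"
  shows "summable (M_term z)"
proof -
  have step: "summable (M_term x)" if "summable (M_term (x\<^sup>2))" for x
  proof -
    have "summable (\<lambda>j. - M_term (x\<^sup>2) j / (1 - x))"
      using that by (intro summable_divide summable_minus)
    then have "summable (\<lambda>j. M_term x (Suc j))"
      by (simp only: M_term_Suc)
    then show ?thesis
      by (simp only: summable_Suc_iff)
  qed
  have descend: "summable (M_term (x ^ 2 ^ k)) \<Longrightarrow> summable (M_term x)" for k x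
  proof (induction k)
    case (Suc k)
    then show ?case
      using step[of "x ^ 2 ^ k"] by (simp add: mult.commute flip: power_mult)
  qed simp
  have "\<forall>\<^sub>F k in sequentially. \<bar>z ^ 2 ^ k\<bar> < 1 / 8"
    using power_power2_tendsto_0[OF assms]
    by (intro order_tendstoD(2)[where y = 0] tendsto_rabs_zero) auto
  then obtain k where "\<bar>z ^ 2 ^ k\<bar> < 1 / 8"
    by (auto simp: eventually_sequentially)
  then show ?thesis
    by (intro descend[of z k] summable_rabs_cancel[OF M_term_summable_small]) simp
qed

lemma M_fun_rec:
  assumes "\<bar>z\<bar> < 1"
  shows "(1 - z) * M_fun z = (1 - z) * z - M_fun (z\<^sup>2)"
proof -
  have z2: "\<bar>z\<^sup>2\<bar> < 1" using assms by (simp add: abs_square_less_1)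
  have "M_fun z = M_term z 0 + (\<Sum>j. M_term z (Suc j))"
    unfolding M_fun_eq using M_term_summable[OF assms] by (simp add: suminf_split_head)
  also have "(\<Sum>j. M_term z (Suc j)) = - M_fun (z\<^sup>2) / (1 - z)"
    unfolding M_fun_eq M_term_Suc using M_term_summable[OF z2]
    by (simp add: suminf_divide suminf_minus summable_minus)
  also have "M_term z 0 = z" by (simp add: M_term_def)
  finally show ?thesis using assms by (simp add: field_simps)
qed

section \<open>Iterated functional equations\<close>

lemma abs_power_power2_less_1:
  fixes z :: real
  assumes "\<bar>z\<bar> < 1"
  shows "\<bar>z ^ 2 ^ k\<bar> < 1"
  using assms by (simp add: power_abs power_less_one_iff)

lemma T_fun_iterate:
  assumes "\<bar>z\<bar> < 1"
  shows "T_fun z = P_fun k z * T_fun (z ^ 2 ^ k)"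
proof (induction k)
  case (Suc k)
  then show ?case
    using T_fun_rec[OF abs_power_power2_less_1[OF assms, of k]]
    by (simp add: P_fun_def mult.commute flip: power_mult)
qed (simp add: P_fun_def)

lemma M_fun_iterate:
  assumes "\<bar>z\<bar> < 1"
  shows "P_fun k z * M_fun z = Q_fun k z + (-1) ^ k * M_fun (z ^ 2 ^ k)"
proof (induction k)
  case (Suc k)
  let ?w = "z ^ 2 ^ k"
  have M_rec: "(1 - ?w) * M_fun ?w = (1 - ?w) * ?w - M_fun (z ^ 2 ^ Suc k)"
    using M_fun_rec[OF abs_power_power2_less_1[OF assms, of k]]
    by (simp add: mult.commute flip: power_mult)
  have "P_fun (Suc k) z * M_fun z = (1 - ?w) * (P_fun k z * M_fun z)"
    by (simp add: P_fun_def)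
  also have "\<dots> = (1 - ?w) * Q_fun k z + (-1) ^ k * ((1 - ?w) * M_fun ?w)"
    unfolding Suc by (simp only: distrib_left mult.left_commute)
  also have "\<dots> = Q_fun (Suc k) z + (-1) ^ Suc k * M_fun (z ^ 2 ^ Suc k)"
    unfolding M_rec by (simp add: algebra_simps)
  finally show ?case .
qed (simp add: P_fun_def)

section \<open>Linear forms with integer polynomial coefficients\<close>

text \<open>Polynomials are integer lists, constant term first, so that the vanishing orders of
  explicit products can be checked by evaluation.\<close>

abbreviation peval :: "int list \<Rightarrow> real \<Rightarrow> real" where
  "peval xs w \<equiv> horner_sum real_of_int w xs"

fun padd :: "int list \<Rightarrow> int list \<Rightarrow> int list" where
  "padd [] ys = ys"
| "padd xs [] = xs"
| "padd (x # xs) (y # ys) = (x + y) # padd xs ys"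

fun pmul :: "int list \<Rightarrow> int list \<Rightarrow> int list" where
  "pmul [] ys = []"
| "pmul (x # xs) ys = padd (map ((*) x) ys) (0 # pmul xs ys)"

lemma peval_padd [simp]: "peval (padd xs ys) w = peval xs w + peval ys w"
  by (induction xs ys rule: padd.induct) (auto simp: algebra_simps)

lemma peval_map_mult [simp]: "peval (map ((*) x) ys) w = real_of_int x * peval ys w"
  by (induction ys) (auto simp: algebra_simps)

lemma peval_pmul [simp]: "peval (pmul xs ys) w = peval xs w * peval ys w"
  by (induction xs) (auto simp: algebra_simps)

lemma peval_replicate_0 [simp]: "peval (replicate n 0) w = 0"
  by (induction n) auto

fun P_list :: "nat \<Rightarrow> int list" where
  "P_list 0 = [1]"
| "P_list (Suc k) = padd (P_list k) (replicate (2 ^ k) 0 @ map uminus (P_list k))"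

fun Q_list :: "nat \<Rightarrow> int list" where
  "Q_list 0 = []"
| "Q_list (Suc k) = (let q = padd (Q_list k) (replicate (2 ^ k) 0 @ [(-1) ^ k])
     in padd q (replicate (2 ^ k) 0 @ map uminus q))"

lemma peval_map_uminus [simp]: "peval (map uminus ys) w = - peval ys w"
  by (induction ys) (auto simp: algebra_simps)

lemma peval_P_list: "peval (P_list k) z = P_fun k z"
  by (induction k) (auto simp: P_fun_def horner_sum_append algebra_simps)

lemma peval_Q_list: "peval (Q_list k) z = Q_fun k z"
  by (induction k) (auto simp: Let_def horner_sum_append algebra_simps)

text \<open>This is \<open>P_fun 6\<close> times the form A0 + A1 T + A2 M, with T(z^64) replaced by
  1 and M(z^64) by 0, hence correct modulo z^64. Level 6 suffices because the orders in use stay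
  below 64.\<close>

definition form_product :: "int list \<Rightarrow> int list \<Rightarrow> int list \<Rightarrow> int list" where
  "form_product A0 A1 A2 =
     padd (pmul A0 (P_list 6)) (padd (pmul A1 (pmul (P_list 6) (P_list 6))) (pmul A2 (Q_list 6)))"

definition vanishes :: "nat \<Rightarrow> int list \<Rightarrow> bool" where
  "vanishes s xs \<longleftrightarrow> s < length xs \<and> take s xs = replicate s 0 \<and> xs ! s \<noteq> 0"

definition form_value :: "int list \<Rightarrow> int list \<Rightarrow> int list \<Rightarrow> real \<Rightarrow> real" where
  "form_value A0 A1 A2 w = peval A0 w + peval A1 w * T_fun w + peval A2 w * M_fun w"

lemma peval_tendsto: "((\<lambda>w. peval xs w) \<longlongrightarrow> peval xs x) (at x)"
  by (induction xs) (auto intro!: tendsto_intros)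

lemma vanishes_peval:
  assumes "vanishes s xs"
  shows "\<exists>ys. \<forall>w. peval xs w = w ^ s * (real_of_int (xs ! s) + w * peval ys w)"
proof -
  have "xs = replicate s 0 @ (xs ! s) # drop (Suc s) xs"
    using assms id_take_nth_drop[of s xs] by (simp add: vanishes_def)
  then have "peval xs w = w ^ s * (real_of_int (xs ! s) + w * peval (drop (Suc s) xs) w)" for w
    by (metis horner_sum_append horner_sum_simps(2) length_replicate peval_replicate_0 add_0)
  then show ?thesis by blast
qed

lemma tendsto_div_power_0:
  fixes f :: "real \<Rightarrow> real"
  assumes "\<And>u. \<bar>u\<bar> \<le> 1 / 8 \<Longrightarrow> \<bar>f u\<bar> \<le> C * \<bar>u\<bar>" and "s < m"
  shows "((\<lambda>w. f (w ^ m) / w ^ s) \<longlongrightarrow> 0) (at 0)"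
proof (rule Lim_null_comparison)
  show "\<forall>\<^sub>F w in at 0. norm (f (w ^ m) / w ^ s) \<le> C * \<bar>w\<bar> ^ (m - s)"
    unfolding eventually_at
  proof (intro exI[of _ "1 / 8"] conjI ballI impI)
    fix w :: real assume "w \<noteq> 0 \<and> dist w 0 < 1 / 8"
    then have w: "w \<noteq> 0" "\<bar>w\<bar> < 1 / 8" by auto
    have "\<bar>w ^ m\<bar> \<le> \<bar>w\<bar> ^ 1"
      unfolding power_abs using w assms(2) by (intro power_decreasing) auto
    then have "\<bar>f (w ^ m)\<bar> \<le> C * \<bar>w ^ m\<bar>"
      using w assms(1) by simp
    also have "\<bar>w ^ m\<bar> = \<bar>w\<bar> ^ (m - s) * \<bar>w\<bar> ^ s"
      using assms(2) by (simp add: power_abs flip: power_add)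
    finally show "norm (f (w ^ m) / w ^ s) \<le> C * \<bar>w\<bar> ^ (m - s)"
      using w by (simp add: field_simps power_abs)
  qed auto
  show "((\<lambda>w. C * \<bar>w\<bar> ^ (m - s)) \<longlongrightarrow> 0) (at 0)"
    using assms(2) by (auto intro!: tendsto_eq_intros)
qed

text \<open>\<open>P_fun 6\<close> times the form differs from the polynomial
  \<open>form_product\<close> by multiples of T(w^64) - 1 and M(w^64). These are of order w^64,
  negligible against w^s, and \<open>P_fun 6\<close> tends to 1.\<close>

lemma form_value_tendsto:
  assumes v: "vanishes s (form_product A0 A1 A2)" and s: "s < 64"
  shows "((\<lambda>w. form_value A0 A1 A2 w / w ^ s) \<longlongrightarrow> real_of_int (form_product A0 A1 A2 ! s)) (at 0)"
proof -
  define c where "c = real_of_int (form_product A0 A1 A2 ! s)"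
  obtain ys where ys: "peval (form_product A0 A1 A2) w = w ^ s * (c + w * peval ys w)" for w
    using vanishes_peval[OF v] by (auto simp: c_def)
  have P: "((\<lambda>w. P_fun 6 w) \<longlongrightarrow> 1) (at 0)"
    unfolding P_fun_def by (auto intro!: tendsto_eq_intros simp: power_0_left)
  define g where "g w = (c + w * peval ys w
     + peval A1 w * (P_fun 6 w)\<^sup>2 * ((T_fun (w ^ 64) - 1) / w ^ s)
     + peval A2 w * (M_fun (w ^ 64) / w ^ s)) / P_fun 6 w" for w
  have "(g \<longlongrightarrow> (c + 0 * peval ys 0 + peval A1 0 * 1\<^sup>2 * 0 + peval A2 0 * 0) / 1) (at 0)"
    unfolding g_def
    using T_fun_minus_1_bound M_fun_bound s
    by (intro tendsto_intros peval_tendsto P tendsto_div_power_0[where C = 4 and f = "\<lambda>u. T_fun u - 1"]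
        tendsto_div_power_0[where C = 4 and f = M_fun]) auto
  then have "(g \<longlongrightarrow> c) (at 0)" by simp
  moreover have "\<forall>\<^sub>F w in at 0. g w = form_value A0 A1 A2 w / w ^ s"
  proof -
    have "\<forall>\<^sub>F w in at (0::real). w \<in> ball 0 1 - {0}"
      by (intro eventually_at_in_open) auto
    then show ?thesis
    proof eventually_elim
      case (elim w)
      then have w: "w \<noteq> 0" "\<bar>w\<bar> < 1" by auto
      have P0: "P_fun 6 w \<noteq> 0"
        using T_fun_iterate[OF w(2), of 6] T_fun_nonzero[OF w(2)] by auto
      have "P_fun 6 w * form_value A0 A1 A2 w
          = peval A0 w * P_fun 6 w + peval A1 w * P_fun 6 w * T_fun w + peval A2 w * (P_fun 6 w * M_fun w)"
        by (simp add: form_value_def algebra_simps)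
      also have "\<dots> = peval (form_product A0 A1 A2) w
           + peval A1 w * (P_fun 6 w)\<^sup>2 * (T_fun (w ^ 64) - 1) + peval A2 w * M_fun (w ^ 64)"
        using T_fun_iterate[OF w(2), of 6] M_fun_iterate[OF w(2), of 6]
        by (simp add: form_product_def peval_P_list peval_Q_list algebra_simps power2_eq_square
            del: P_list.simps Q_list.simps Q_fun.simps)
      also have "\<dots> = P_fun 6 w * (g w * w ^ s)"
        using w P0 by (simp add: ys g_def field_simps)
      finally show ?case using w P0 by (simp add: field_simps)
    qed
  qed
  ultimately show ?thesis
    unfolding c_def by (rule Lim_transform_eventually)
qed

section \<open>Arithmetic and size of the forms at level k\<close>

lemma length_padd [simp]: "length (padd xs ys) = max (length xs) (length ys)"
  by (induction xs ys rule: padd.induct) auto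

lemma length_P_list [simp]: "length (P_list k) = 2 ^ k"
  by (induction k) auto

lemma length_Q_list: "length (Q_list k) \<le> Suc (2 ^ k)"
  by (induction k) (auto simp: Let_def)

lemma peval_clear_denominator:
  assumes "length xs \<le> Suc m" "v \<noteq> 0"
  shows "real_of_int v ^ m * peval xs (real_of_int u / real_of_int v) \<in> \<int>"
  using assms(1)
proof (induction xs arbitrary: m)
  case (Cons x xs)
  show ?case
  proof (cases m)
    case 0
    then show ?thesis using Cons.prems by simp
  next
    case (Suc m')
    have "real_of_int v ^ m * peval (x # xs) (real_of_int u / real_of_int v)
        = real_of_int v ^ m * x + u * (real_of_int v ^ m' * peval xs (real_of_int u / real_of_int v))"
      using assms(2) by (simp add: Suc field_simps)
    also have "\<dots> \<in> \<int>"
      using Cons.prems Suc by (intro Ints_add Ints_mult Cons.IH Ints_power) auto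
    finally show ?thesis .
  qed
qed simp

text \<open>Solving the iterated equations for T(w) and M(w) and multiplying the form at w by P_k(z)
  gives this constant term. The coefficient of T(z) is just A1(w), since P_k(z) T(w) = T(z).\<close>

definition level_form0 :: "int list \<Rightarrow> int list \<Rightarrow> real \<Rightarrow> nat \<Rightarrow> real" where
  "level_form0 A0 A2 z k =
     P_fun k z * peval A0 (z ^ 2 ^ k) - (-1) ^ k * peval A2 (z ^ 2 ^ k) * P_fun k z * Q_fun k z"

definition level_form2 :: "int list \<Rightarrow> real \<Rightarrow> nat \<Rightarrow> real" where
  "level_form2 A2 z k = (-1) ^ k * peval A2 (z ^ 2 ^ k) * (P_fun k z)\<^sup>2"

lemma level_form_eq:
  assumes "\<bar>z\<bar> < 1"
  shows "level_form0 A0 A2 z k + peval A1 (z ^ 2 ^ k) * T_fun z + level_form2 A2 z k * M_fun z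
    = P_fun k z * form_value A0 A1 A2 (z ^ 2 ^ k)"
proof -
  let ?w = "z ^ 2 ^ k"
  have "level_form2 A2 z k * M_fun z = (-1) ^ k * peval A2 ?w * P_fun k z * (P_fun k z * M_fun z)"
    by (simp add: level_form2_def power2_eq_square)
  also have "\<dots> = (-1) ^ k * peval A2 ?w * P_fun k z * Q_fun k z
      + ((-1) ^ k * (-1) ^ k) * (peval A2 ?w * P_fun k z * M_fun ?w)"
    unfolding M_fun_iterate[OF assms] by (simp add: algebra_simps del: minus_one_mult_self)
  also have "(-1) ^ k * (-1) ^ k = (1::real)" by simp
  finally show ?thesis
    unfolding T_fun_iterate[OF assms, of k]
    by (simp add: level_form0_def form_value_def algebra_simps)
qed

text \<open>Count powers of v = b^(2^k): each of P_k and Q_k needs one, a polynomial of degree m in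
  w needs m. The degree limits d - 1, d, d - 2 make every product fit into v^d.\<close>

lemma level_form_ints:
  fixes a b :: int
  assumes b: "b \<noteq> 0" and d: "2 \<le> d"
    and len: "length A0 \<le> d" "length A1 \<le> Suc d" "Suc (length A2) \<le> d"
  defines "z \<equiv> real_of_int a / real_of_int b"
  shows "real_of_int b ^ (d * 2 ^ k) * level_form0 A0 A2 z k \<in> \<int>"
    and "real_of_int b ^ (d * 2 ^ k) * peval A1 (z ^ 2 ^ k) \<in> \<int>"
    and "real_of_int b ^ (d * 2 ^ k) * level_form2 A2 z k \<in> \<int>"
proof -
  define v where "v = real_of_int b ^ 2 ^ k"
  have vd: "real_of_int b ^ (d * 2 ^ k) = v ^ d"
    by (simp add: v_def mult.commute flip: power_mult)
  have A: "v ^ m * peval xs (z ^ 2 ^ k) \<in> \<int>" if "length xs \<le> Suc m" for m xs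
    using peval_clear_denominator[OF that, of "b ^ 2 ^ k" "a ^ 2 ^ k"] b
    by (simp add: v_def z_def power_divide)
  have P: "v * P_fun k z \<in> \<int>"
    using peval_clear_denominator[of "P_list k" "2 ^ k" b a] b
    by (simp add: v_def z_def peval_P_list)
  have Q: "v * Q_fun k z \<in> \<int>"
    using peval_clear_denominator[OF length_Q_list, of b k a] b
    by (simp add: v_def z_def peval_Q_list)
  obtain e where e: "d = Suc (Suc e)" using d by (metis add_2_eq_Suc le_Suc_ex)
  have "v ^ d * level_form0 A0 A2 z k = (v * P_fun k z) * (v ^ Suc e * peval A0 (z ^ 2 ^ k))
      - (-1) ^ k * (v ^ e * peval A2 (z ^ 2 ^ k)) * (v * P_fun k z) * (v * Q_fun k z)"
    by (simp add: level_form0_def e algebra_simps)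
  also have "\<dots> \<in> \<int>"
    using len e by (intro Ints_diff Ints_mult P Q A Ints_power) auto
  finally show "real_of_int b ^ (d * 2 ^ k) * level_form0 A0 A2 z k \<in> \<int>" by (simp add: vd)
  show "real_of_int b ^ (d * 2 ^ k) * peval A1 (z ^ 2 ^ k) \<in> \<int>"
    unfolding vd using len by (intro A)
  have "v ^ d * level_form2 A2 z k
      = (-1) ^ k * (v ^ e * peval A2 (z ^ 2 ^ k)) * (v * P_fun k z) * (v * P_fun k z)"
    by (simp add: level_form2_def e algebra_simps power2_eq_square)
  also have "\<dots> \<in> \<int>"
    using len e by (intro Ints_mult P A Ints_power) auto
  finally show "real_of_int b ^ (d * 2 ^ k) * level_form2 A2 z k \<in> \<int>" by (simp add: vd)
qed

text \<open>The value divided by w^s tends to T(z) times the leading coefficient, which is nonzero.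
  Quantifying over all large \<open>E\<close> lets several forms share one constant.\<close>

lemma level_form_bounds:
  assumes z: "\<bar>z\<bar> < 1" "z \<noteq> 0" and v: "vanishes s (form_product A0 A1 A2)" "s < 64"
  shows "\<forall>\<^sub>F E in at_top. \<forall>\<^sub>F k in sequentially.
    \<bar>peval A1 (z ^ 2 ^ k)\<bar> \<le> E \<and> \<bar>level_form2 A2 z k\<bar> \<le> E \<and>
    \<bar>z\<bar> ^ (s * 2 ^ k) / E \<le> \<bar>P_fun k z * form_value A0 A1 A2 (z ^ 2 ^ k)\<bar> \<and>
    \<bar>P_fun k z * form_value A0 A1 A2 (z ^ 2 ^ k)\<bar> \<le> E * \<bar>z\<bar> ^ (s * 2 ^ k)"
proof -
  define l where "l = \<bar>T_fun z * real_of_int (form_product A0 A1 A2 ! s)\<bar>"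
  have l: "l > 0" using T_fun_nonzero[OF z(1)] v(1) by (simp add: l_def vanishes_def)
  have w: "filterlim (\<lambda>k. z ^ 2 ^ k) (at 0) sequentially"
    using power_power2_tendsto_0[OF z(1)] z(2) by (auto simp: filterlim_at)
  have A: "(\<lambda>k. \<bar>peval xs (z ^ 2 ^ k)\<bar>) \<longlonglongrightarrow> \<bar>peval xs 0\<bar>" for xs
    by (intro tendsto_rabs filterlim_compose[OF peval_tendsto w])
  have P: "(\<lambda>k. P_fun k z) \<longlonglongrightarrow> T_fun z"
    using z(1) by (rule P_fun_tendsto_T_fun)
  have L2: "(\<lambda>k. \<bar>level_form2 A2 z k\<bar>) \<longlonglongrightarrow> \<bar>peval A2 0\<bar> * (T_fun z)\<^sup>2"
    unfolding level_form2_def abs_mult power_abs abs_minus_cancel abs_one power_one mult_1 power2_abs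
    by (intro tendsto_intros A P)
  have R: "(\<lambda>k. \<bar>P_fun k z * (form_value A0 A1 A2 (z ^ 2 ^ k) / (z ^ 2 ^ k) ^ s)\<bar>) \<longlonglongrightarrow> l"
    unfolding l_def
    by (intro tendsto_intros P filterlim_compose[OF form_value_tendsto[OF v] w])
  have "\<forall>\<^sub>F E in at_top. E > \<bar>peval A1 0\<bar> \<and> E > \<bar>peval A2 0\<bar> * (T_fun z)\<^sup>2 \<and> E > l \<and> E > 1 / l"
    by (intro eventually_conj eventually_gt_at_top)
  then show ?thesis
  proof eventually_elim
    case (elim E)
    then have E: "E > 0" "1 / E < l" using l by (auto simp: field_simps intro: less_trans)
    have "\<forall>\<^sub>F k in sequentially. \<bar>peval A1 (z ^ 2 ^ k)\<bar> < E"
         "\<forall>\<^sub>F k in sequentially. \<bar>level_form2 A2 z k\<bar> < E"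
         "\<forall>\<^sub>F k in sequentially. \<bar>P_fun k z * (form_value A0 A1 A2 (z ^ 2 ^ k) / (z ^ 2 ^ k) ^ s)\<bar> < E"
         "\<forall>\<^sub>F k in sequentially. 1 / E < \<bar>P_fun k z * (form_value A0 A1 A2 (z ^ 2 ^ k) / (z ^ 2 ^ k) ^ s)\<bar>"
      by (rule order_tendstoD(2)[OF A] order_tendstoD(2)[OF L2] order_tendstoD[OF R];
          use elim E in blast)+
    then show ?case
    proof eventually_elim
      case (elim k)
      have w_s: "\<bar>(z ^ 2 ^ k) ^ s\<bar> = \<bar>z\<bar> ^ (s * 2 ^ k)"
        by (simp add: power_abs mult.commute flip: power_mult)
      have "\<bar>P_fun k z * (form_value A0 A1 A2 (z ^ 2 ^ k) / (z ^ 2 ^ k) ^ s)\<bar>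
          = \<bar>P_fun k z * form_value A0 A1 A2 (z ^ 2 ^ k)\<bar> / \<bar>z\<bar> ^ (s * 2 ^ k)"
        by (simp only: w_s[symmetric] abs_mult abs_divide times_divide_eq_right)
      then show ?case
        using elim z(2) E by (simp add: field_simps less_imp_le w_s)
    qed
  qed
qed

section \<open>Three explicit forms\<close>

text \<open>The coefficient lists were found by solving, over the rationals, the linear systems for vanishing
  orders 32, 42 and 52. Together with the next level \<open>z \<mapsto> z\<^sup>2\<close>, where 8 and 32 become 16 and 64, these
  degrees and orders satisfy the gap conditions required by the criterion; the ratio 52 : 18, with
  64 following, is the extremal one and produces the exponent.\<close>

definition "degs = [8, 13, 18 :: nat]"
definition "ords = [32, 42, 52 :: nat]"

definition "forms0 =
  [[1, -3, 5, 1, -13, 7, 7, -5],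
   [-2, -4, 9, 6, -13, 8, -14, -12, 36, -4, 4, 8, -26],
   [-1, -7, 1, -5, 12, 52, -37, -47, -6, -66, 79, 117, -12, 12, -43, -65, 6, 6 :: int]]"

definition "forms1 =
  [[-1, 0, 0, 0, -2, 0, 0, 0, -1],
   [2, 2, 3, 3, 3, 3, 2, 2, 4, 4, 4, 4, 2, 2],
   [1, 2, 8, 14, 15, 16, 13, 10, 7, 4, 11, 18, 17, 16, 11, 6, 1, -4, -2 :: int]]"

definition "forms2 =
  [[2, -4, -2, 8, -2, -4, 2],
   [4, -4, -6, 6, -8, 8, 12, -12, 4, -4, -8, 8],
   [6, 0, 6, 0, -40, 0, 10, 0, 60, 0, -38, 0, -24, 0, 22 :: int]]"

text \<open>A finite integer computation; the quantifier over a list makes it executable.\<close>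

lemma forms_vanish:
  "\<forall>j\<in>set [0..<3]. vanishes (ords ! j) (form_product (forms0 ! j) (forms1 ! j) (forms2 ! j))"
  by code_simp

lemma forms_length:
  "\<forall>j\<in>set [0..<3]. 2 \<le> degs ! j \<and> length (forms0 ! j) \<le> degs ! j \<and> length (forms1 ! j) \<le> Suc (degs ! j)
     \<and> Suc (length (forms2 ! j)) \<le> degs ! j \<and> ords ! j < 64"
  by code_simp

text \<open>The n-th form is number n mod 3 at level k0 + n div 3. To base b, \<open>d\<close> and
  \<open>e\<close> are the logarithms of \<open>N n\<close> and 1 / \<open>eps n\<close>; the first
  two conclusions are the gap conditions, the third gives the limit 0.\<close>

lemma exponent_gaps:
  fixes lam :: real and k0 :: nat
  assumes lam: "0 \<le> lam" "lam < 1 / 2"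
  defines "mu0 \<equiv> 32 * (1 - lam) / (17 - 26 * lam)"
    and "d \<equiv> \<lambda>n. real (degs ! (n mod 3) * 2 ^ (k0 + n div 3))"
    and "e \<equiv> \<lambda>n. (1 - lam) * real (ords ! (n mod 3) * 2 ^ (k0 + n div 3))"
  shows "e (Suc n) \<le> mu0 * (e n - d n)" "d (Suc n) \<le> (mu0 - 1) * (e n - d n)" "real n \<le> e n - d n"
proof -
  define t :: real where "t = 2 ^ (k0 + n div 3)"
  have t: "t > 0" by (simp add: t_def)
  have D: "17 - 26 * lam > 0" using lam by simp
  have mu1: "mu0 - 1 = (15 - 6 * lam) / (17 - 26 * lam)"
    using D by (simp add: mu0_def field_simps)
  have g1: "(1 - lam) * s' \<le> mu0 * c" if "s' * (17 - 26 * lam) \<le> 32 * c" for s' c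
    using mult_left_mono[OF that, of "1 - lam"] lam D by (simp add: mu0_def field_simps)
  have g2: "d' \<le> (mu0 - 1) * c" if "d' * (17 - 26 * lam) \<le> (15 - 6 * lam) * c" for d' c
    using that D by (simp add: mu1 field_simps)
  have q1: "13 * (17 - 26 * lam) \<le> (15 - 6 * lam) * (24 - 32 * lam)"
  proof -
    have "(15 - 6 * lam) * (24 - 32 * lam) - 13 * (17 - 26 * lam) = 192 * (lam - 3 / 4)\<^sup>2 + (31 + 2 * lam)"
      by (simp add: algebra_simps power2_eq_square)
    also have "\<dots> \<ge> 0" using lam by simp
    finally show ?thesis by simp
  qed
  have q2: "18 * (17 - 26 * lam) \<le> (15 - 6 * lam) * (29 - 42 * lam)"
  proof -
    have "(15 - 6 * lam) * (29 - 42 * lam) - 18 * (17 - 26 * lam) = 252 * (lam - 2 / 3)\<^sup>2 + 17"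
      by (simp add: algebra_simps power2_eq_square)
    also have "\<dots> \<ge> 0" by simp
    finally show ?thesis by simp
  qed
  \<comment> \<open>As 34 - 52 lam = 2 (17 - 26 lam), only 16 \<le> 2 (15 - 6 lam) remains.\<close>
  have q3: "16 * (17 - 26 * lam) \<le> (15 - 6 * lam) * (34 - 52 * lam)"
    using mult_right_mono[of 16 "2 * (15 - 6 * lam)" "17 - 26 * lam"] lam by (simp add: algebra_simps)
  have scale: "x * t \<le> m * (y * t)" if "x \<le> m * y" for x m y
    using mult_right_mono[OF that, of t] t by (simp add: mult.assoc)
  \<comment> \<open>\<open>c\<close> is (1 - lam) times the order minus the degree; its three values
    decrease in lam and all equal 8 at lam = 1/2. \<open>d'\<close> and \<open>s'\<close> belong to
    the next form.\<close>
  have vals: "\<exists>c d' s'. e n - d n = c * t \<and> d (Suc n) = d' * t \<and> e (Suc n) = (1 - lam) * s' * t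
      \<and> (1 - lam) * s' \<le> mu0 * c \<and> d' \<le> (mu0 - 1) * c \<and> 8 \<le> c"
  proof -
    consider "n mod 3 = 0" | "n mod 3 = 1" | "n mod 3 = 2" by linarith
    then show ?thesis
    proof cases
      case 1
      then have S: "Suc n mod 3 = 1" "Suc n div 3 = n div 3" by presburger+
      show ?thesis
        using g1[of 42 "24 - 32 * lam"] g2[OF q1] lam
        by (intro exI[of _ "24 - 32 * lam"] exI[of _ 13] exI[of _ 42])
          (simp add: d_def e_def S 1 degs_def ords_def t_def algebra_simps)
    next
      case 2
      then have S: "Suc n mod 3 = 2" "Suc n div 3 = n div 3" by presburger+
      show ?thesis
        using g1[of 52 "29 - 42 * lam"] g2[OF q2] lam
        by (intro exI[of _ "29 - 42 * lam"] exI[of _ 18] exI[of _ 52])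
          (simp add: d_def e_def S 2 degs_def ords_def t_def algebra_simps)
    next
      case 3
      then have S: "Suc n mod 3 = 0" "Suc n div 3 = Suc (n div 3)" by presburger+
      \<comment> \<open>The next form is the first one at the doubled level, hence 16 and 64. The
        order condition is an equality here, which fixes \<open>mu0\<close>.\<close>
      show ?thesis
        using g1[of 64 "34 - 52 * lam"] g2[OF q3] lam
        by (intro exI[of _ "34 - 52 * lam"] exI[of _ 16] exI[of _ 64])
          (simp add: d_def e_def S 3 degs_def ords_def t_def algebra_simps)
    qed
  qed
  then obtain c d' s' where c: "e n - d n = c * t" "d (Suc n) = d' * t" "e (Suc n) = (1 - lam) * s' * t"
    "(1 - lam) * s' \<le> mu0 * c" "d' \<le> (mu0 - 1) * c" "8 \<le> c"
    by blast
  show "e (Suc n) \<le> mu0 * (e n - d n)" "d (Suc n) \<le> (mu0 - 1) * (e n - d n)"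
    unfolding c by (rule scale, rule c)+
  have "n div 3 < 2 ^ (n div 3)" by (rule less_exp)
  then have "n \<le> 3 * 2 ^ (n div 3)" by linarith
  also have "\<dots> \<le> 3 * 2 ^ (k0 + n div 3)" by simp
  finally have "n \<le> 3 * 2 ^ (k0 + n div 3)" .
  then have "real n \<le> 3 * t"
    unfolding t_def by (metis of_nat_le_iff of_nat_mult of_nat_numeral of_nat_power)
  also have "\<dots> \<le> c * t" using c(6) t by (intro mult_right_mono) auto
  finally show "real n \<le> e n - d n" by (simp add: c)
qed

text \<open>Since |z| = b^(-(1 - lam)), denominators and sizes are all powers of b, so the criterion
  reduces to linear inequalities between exponents.\<close>

lemma sim_approx_exp_T_M_le:
  fixes a b :: int and lam :: real
  assumes b: "b \<ge> 2" and a: "a \<noteq> 0"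
    and log: "ln (real_of_int \<bar>a\<bar>) = lam * ln (real_of_int b)" and lam: "0 \<le> lam" "lam < 1 / 2"
  shows "sim_approx_exp [T_fun (real_of_int a / real_of_int b), M_fun (real_of_int a / real_of_int b)]
    \<le> ereal (32 * (1 - lam) / (17 - 26 * lam))"
proof (rule sim_approx_exp_pair_le)
  define z where "z = real_of_int a / real_of_int b"
  define mu0 where "mu0 = 32 * (1 - lam) / (17 - 26 * lam)"
  have mu0: "1 \<le> mu0" using lam by (simp add: mu0_def field_simps)
  then show "32 * (1 - lam) / (17 - 26 * lam) \<ge> 0" by (simp add: mu0_def)
  have b1: "real_of_int b > 1" using b by simp
  have "\<bar>real_of_int a\<bar> = real_of_int b powr lam"
    using log a b1 by (simp add: powr_def flip: log)
  then have z_powr: "\<bar>z\<bar> = real_of_int b powr - (1 - lam)"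
    using b1 by (simp add: z_def powr_diff)
  have z: "z \<noteq> 0" "\<bar>z\<bar> < 1"
    using a b1 lam z_powr by (auto simp: z_def powr_less_one)
  define good where "good E j k \<longleftrightarrow>
    \<bar>peval (forms1 ! j) (z ^ 2 ^ k)\<bar> \<le> E \<and> \<bar>level_form2 (forms2 ! j) z k\<bar> \<le> E \<and>
    \<bar>z\<bar> ^ (ords ! j * 2 ^ k) / E \<le> \<bar>P_fun k z * form_value (forms0 ! j) (forms1 ! j) (forms2 ! j) (z ^ 2 ^ k)\<bar> \<and>
    \<bar>P_fun k z * form_value (forms0 ! j) (forms1 ! j) (forms2 ! j) (z ^ 2 ^ k)\<bar> \<le> E * \<bar>z\<bar> ^ (ords ! j * 2 ^ k)"
    for E j k
  \<comment> \<open>Finiteness of the set of forms yields first a common \<open>E\<close>, then a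
    common starting level \<open>k0\<close>.\<close>
  have "\<forall>\<^sub>F E in at_top. \<forall>\<^sub>F k in sequentially. good E j k" if "j \<in> set [0..<3]" for j
    unfolding good_def using forms_vanish forms_length z that by (intro level_form_bounds) auto
  then have "\<forall>\<^sub>F E in at_top. \<forall>j\<in>set [0..<3]. \<forall>\<^sub>F k in sequentially. good E j k"
    by (intro eventually_ball_finite) auto
  then have "\<forall>\<^sub>F E in at_top. (\<forall>j\<in>set [0..<3]. \<forall>\<^sub>F k in sequentially. good E j k) \<and> E > 0"
    by (intro eventually_conj eventually_gt_at_top)
  then obtain E where E: "E > 0" and "\<forall>j\<in>set [0..<3]. \<forall>\<^sub>F k in sequentially. good E j k"
    unfolding eventually_at_top_linorder by blast
  then have "\<forall>\<^sub>F k in sequentially. \<forall>j\<in>set [0..<3]. good E j k"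
    by (intro eventually_ball_finite) auto
  then obtain k0 where "\<forall>k\<ge>k0. \<forall>j\<in>set [0..<3]. good E j k"
    unfolding eventually_sequentially by blast
  then have bounds: "good E j k" if "k \<ge> k0" "j < 3" for j k
    using that by simp
  define j k where "j n = n mod 3" and "k n = k0 + n div 3" for n :: nat
  have jk: "j n < 3" "k0 \<le> k n" for n by (auto simp: j_def k_def)
  define N eps where "N n = real_of_int b ^ (degs ! j n * 2 ^ k n)"
    and "eps n = \<bar>z\<bar> ^ (ords ! j n * 2 ^ k n)" for n
  define d e where "d n = real (degs ! j n * 2 ^ k n)"
    and "e n = (1 - lam) * real (ords ! j n * 2 ^ k n)" for n
  have N: "N n = real_of_int b powr d n" for n
    unfolding N_def d_def using b1 by (subst powr_realpow) auto
  have eps: "eps n = real_of_int b powr - e n" for n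
    using z b1 unfolding eps_def e_def
    by (subst powr_realpow[symmetric]) (simp_all add: z_powr powr_powr algebra_simps)
  have eN: "eps n * N n = real_of_int b powr - (e n - d n)" for n
    by (simp add: N eps flip: powr_add)
  note gaps = exponent_gaps[OF lam, where ?k0.0 = k0, folded mu0_def j_def k_def, folded d_def e_def]
  have lim: "(\<lambda>n. eps n * N n) \<longlonglongrightarrow> 0"
  proof (rule tendsto_sandwich[of "\<lambda>_. 0"])
    show "\<forall>\<^sub>F n in sequentially. eps n * N n \<le> (1 / real_of_int b) ^ n"
    proof (intro always_eventually allI)
      fix n
      have "eps n * N n \<le> real_of_int b powr - real n"
        unfolding eN using gaps(3)[of n] b1 by (intro powr_mono) auto
      then show "eps n * N n \<le> (1 / real_of_int b) ^ n"
        using b1 by (simp add: powr_minus powr_realpow power_divide field_simps)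
    qed
    show "(\<lambda>n. (1 / real_of_int b) ^ n) \<longlonglongrightarrow> 0"
      using b1 by (intro LIMSEQ_realpow_zero) auto
  qed (auto simp: eN)
  fix mu assume "mu > 32 * (1 - lam) / (17 - 26 * lam)"
  then have mu: "mu0 < mu" by (simp add: mu0_def)
  let ?B0 = "\<lambda>n. level_form0 (forms0 ! j n) (forms2 ! j n) z (k n)"
  let ?B1 = "\<lambda>n. peval (forms1 ! j n) (z ^ 2 ^ k n)"
  let ?B2 = "\<lambda>n. level_form2 (forms2 ! j n) z (k n)"
  obtain Q :: real where "\<And>(p1::int) (p2::int) (q::int). q \<ge> 1 \<Longrightarrow>
      \<bar>T_fun z - p1 / q\<bar> < real_of_int q powr - mu \<Longrightarrow>
      \<bar>M_fun z - p2 / q\<bar> < real_of_int q powr - mu \<Longrightarrow> real_of_int q \<le> Q"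
  proof (rule simultaneous_approx_bounded_denominator[of N eps E ?B0 ?B1 ?B2 "T_fun z" "M_fun z" mu0 mu])
    fix n
    have len: "2 \<le> degs ! j n" "length (forms0 ! j n) \<le> degs ! j n" "length (forms1 ! j n) \<le> Suc (degs ! j n)"
      "Suc (length (forms2 ! j n)) \<le> degs ! j n"
      using forms_length jk(1)[of n] by auto
    show "N n * ?B0 n \<in> \<int>" "N n * ?B1 n \<in> \<int>" "N n * ?B2 n \<in> \<int>"
      unfolding N_def z_def using b len by (auto intro!: level_form_ints)
    show "\<bar>?B1 n\<bar> \<le> E" "\<bar>?B2 n\<bar> \<le> E"
      "eps n / E \<le> \<bar>?B0 n + ?B1 n * T_fun z + ?B2 n * M_fun z\<bar>"
      "\<bar>?B0 n + ?B1 n * T_fun z + ?B2 n * M_fun z\<bar> \<le> E * eps n"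
      unfolding level_form_eq[OF z(2)] eps_def using bounds[OF jk(2,1), of n] by (auto simp: good_def)
    show "(eps n * N n) powr mu0 \<le> eps (Suc n)"
      unfolding eN unfolding eps powr_powr using gaps(1)[of n] b1 by (intro powr_mono) (auto simp: algebra_simps)
    show "N (Suc n) \<le> (eps n * N n) powr (1 - mu0)"
      unfolding eN unfolding N powr_powr using gaps(2)[of n] b1 by (intro powr_mono) (auto simp: algebra_simps)
    show "N n > 0" "eps n > 0" using b1 by (auto simp: N eps)
  qed (use E lim mu0 mu in auto)
  then show "\<exists>Q::real. \<forall>(p1::int) (p2::int) (q::int). q \<ge> 1 \<longrightarrow>
      \<bar>T_fun (real_of_int a / real_of_int b) - p1 / q\<bar> < real_of_int q powr - mu \<longrightarrow>
      \<bar>M_fun (real_of_int a / real_of_int b) - p2 / q\<bar> < real_of_int q powr - mu \<longrightarrow>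
      real_of_int q \<le> Q"
    unfolding z_def by blast
qed

theorem theorem2:
  shows "(\<forall>b::int. b \<ge> 2 \<longrightarrow>
            sim_approx_exp [T_fun (1 / real_of_int b), M_fun (1 / real_of_int b)] \<le> ereal (32 / 17))
       \<and> (\<forall>(a::int) (b::int) (lam::real). b \<ge> 2 \<longrightarrow> a \<noteq> 0 \<longrightarrow>
            ln (real_of_int \<bar>a\<bar>) = lam * ln (real_of_int b) \<longrightarrow> 0 \<le> lam \<longrightarrow> lam < 1 / 2 \<longrightarrow>
            sim_approx_exp [T_fun (real_of_int a / real_of_int b), M_fun (real_of_int a / real_of_int b)]
              \<le> ereal (32 * (1 - lam) / (17 - 26 * lam)))"
  \<comment> \<open>The first claim is the instance a = 1, lam = 0.\<close>
  using sim_approx_exp_T_M_le sim_approx_exp_T_M_le[of _ 1 0] by auto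

end
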